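(* Let $(T,+)$ be a commutative semigroup with identity $0$. Let $k,m,n\in\mathbb{N}$, and let $M$ be a $k\times m$ matrix with entries in $\omega$. For $i\in\{1,2,\ldots,m\}$, let $\tau_i$ be an $S_0$-independent homomorphism from $S_n$ to $T$. Define a function $\psi$ on $S_n$ by $$\psi(w)=\begin{pmatrix}\tau_1(w)\\ \tau_2(w)\\ \vdots\\ \tau_m(w)\end{pmatrix},$$ and suppose that for any collection $\{C_i : i\in\{1,2,\ldots,k\}\}$ of IP-sets in $T$ there exists $a\in S_n$ such that $M\psi(a)\in \times_{i=1}^{k} C_i$. Let $F$ be a finite nonempty set of $S_0$-preserving homomorphisms from $S_n$ to $S_0$, and let $D\subseteq S_0$ be a $J$-set in $S_0$. For $1\le i\le k$, let $B_i=\mathrm{FS}(\langle x_t^{(i)}\rangle_{t=1}^{\infty})$ be an IP-set in $T$, where $\langle x_t^{(i)}\rangle_{t=1}^\infty$ is a sequence in $T$. Then there exists $w\in S_n$ such that $\nu(w)\in D$ for every $\nu\in F$ and $M\psi(w)\in\times_{i=1}^{k}B_i$.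
   Context: $\mathbb{N}$ is the set of positive integers and $\omega=\mathbb{N}\cup\{0\}$. $\mathcal{P}_f(X)$ is the set of nonempty finite subsets of $X$. $\mathbb{A}$ is a nonempty set (alphabet). $S_0$ is the set of all finite words $a_1a_2\cdots a_l$ with $l\ge 1$ and letters in $\mathbb{A}$; it is a semigroup under concatenation. For $n\in\mathbb{N}$, let $v_1,\ldots,v_n$ be distinct variables not in $\mathbb{A}$. $S_n$ is the set of $n$-variable words over $\mathbb{A}$, i.e. words over $\mathbb{A}\cup\{v_1,\ldots,v_n\}$ in which each $v_i$ ($1\le i\le n$) occurs at least once. Under concatenation, $S_n$ and $S_n\cup S_0$ are semigroups and $S_n$ is an ideal of $S_n\cup S_0$. A homomorphism $\nu:S_n\to S_0$ is $S_0$-preserving if $\nu(uw)=u\,\nu(w)$ and $\nu(wu)=\nu(w)\,u$ for all $u\in S_0$, $w\in S_n$. A homomorphism $\tau:S_n\to T$ is $S_0$-independent if $\tau(uw)=\tau(w)=\tau(wu)$ for all $u\in S_0$, $w\in S_n$. $J$-set: let $(S,\cdot)$ be a semigroup, let ${}^{\mathbb{N}}S$ be the set of all sequences in $S$, and let $\mathcal{J}_m=\{(t_1,\ldots,t_m)\in\mathbb{N}^m : t_1<t_2<\cdots<t_m\}$. A set $A\subseteq S$ is a $J$-set (in $S$) if and only if for each $F\in\mathcal{P}_f({}^{\mathbb{N}}S)$ there exist $m\in\mathbb{N}$, $a=(a_1,\ldots,a_{m+1})\in S^{m+1}$ and $t=(t_1,\ldots,t_m)\in\mathcal{J}_m$ such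 that for each $f\in F$, $\left(\prod_{j=1}^{m}a_j\cdot f(t_j)\right)\cdot a_{m+1}\in A$, where the product is taken in increasing order of indices. For a sequence $\langle x_t\rangle_{t=1}^\infty$ in $T$, $\mathrm{FS}(\langle x_t\rangle_{t=1}^\infty)=\{\sum_{t\in H}x_t : H\in\mathcal{P}_f(\mathbb{N})\}$. An IP-set in $T$ is a set containing $\mathrm{FS}(\langle x_t\rangle_{t=1}^\infty)$ for some sequence $\langle x_t\rangle_{t=1}^\infty$ in $T$. For $c\in\omega$ and $x\in T$, $c\,x$ denotes the $c$-fold sum of $x$ (with $0\,x=0$), and matrix multiplication $M\psi(w)\in T^k$ is defined in the usual way, so that it makes sense and distributes over addition. *)

theory Defs
  imports "HOL-Analysis.Finite_Cartesian_Product" "HOL-Library.FuncSet"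
begin

datatype 'a symb = Letter 'a | Var nat

text \<open>
  \<open>words A n\<close> is the set of \<open>n\<close>-variable words over the alphabet \<open>A\<close>; for \<open>n = 0\<close> these are the
  nonempty words over \<open>A\<close>, so that all the semigroups involved live in one list type with
  concatenation as operation. The variables are numbered from 1.
\<close>
definition words :: "'a set \<Rightarrow> nat \<Rightarrow> 'a symb list set" where
  "words A n = {w. w \<noteq> [] \<and> set w \<subseteq> Letter ` A \<union> Var ` {1..n} \<and> Var ` {1..n} \<subseteq> set w}"

definition semigroup_hom ::
  "'s set \<Rightarrow> ('s \<Rightarrow> 's \<Rightarrow> 's) \<Rightarrow> 't set \<Rightarrow> ('t \<Rightarrow> 't \<Rightarrow> 't) \<Rightarrow> ('s \<Rightarrow> 't) \<Rightarrow> bool" where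
  "semigroup_hom S p T q h \<longleftrightarrow>
     h \<in> S \<rightarrow> T \<and> (\<forall>x\<in>S. \<forall>y\<in>S. h (p x y) = q (h x) (h y))"

definition S0_preserving :: "'a set \<Rightarrow> nat \<Rightarrow> ('a symb list \<Rightarrow> 'a symb list) \<Rightarrow> bool" where
  "S0_preserving A n \<nu> \<longleftrightarrow>
     semigroup_hom (words A n) (@) (words A 0) (@) \<nu> \<and>
     (\<forall>u\<in>words A 0. \<forall>w\<in>words A n. \<nu> (u @ w) = u @ \<nu> w \<and> \<nu> (w @ u) = \<nu> w @ u)"

definition S0_independent ::
  "'a set \<Rightarrow> nat \<Rightarrow> ('a symb list \<Rightarrow> 'b::comm_monoid_add) \<Rightarrow> bool" where
  "S0_independent A n \<tau> \<longleftrightarrow>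
     semigroup_hom (words A n) (@) UNIV (+) \<tau> \<and>
     (\<forall>u\<in>words A 0. \<forall>w\<in>words A n. \<tau> (u @ w) = \<tau> w \<and> \<tau> w = \<tau> (w @ u))"

text \<open>The product \<open>x 1 \<cdot> \<dots> \<cdot> x m\<close> in increasing order of indices, meaningful for \<open>m \<ge> 1\<close>.\<close>
definition ordered_prod :: "('s \<Rightarrow> 's \<Rightarrow> 's) \<Rightarrow> (nat \<Rightarrow> 's) \<Rightarrow> nat \<Rightarrow> 's" where
  "ordered_prod p x m = foldl p (x 1) (map x [2..<Suc m])"

text \<open>
  \<open>J_set S p D\<close>: \<open>D\<close> is a \<open>J\<close>-set in the semigroup with carrier \<open>S\<close> and operation \<open>p\<close>.
  Sequences and tuples are functions on \<open>nat\<close> indexed from 1; their values at other arguments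
  are irrelevant.
\<close>
definition J_set :: "'s set \<Rightarrow> ('s \<Rightarrow> 's \<Rightarrow> 's) \<Rightarrow> 's set \<Rightarrow> bool" where
  "J_set S p D \<longleftrightarrow> D \<subseteq> S \<and>
     (\<forall>F. finite F \<and> F \<noteq> {} \<and> F \<subseteq> ({1..} \<rightarrow> S) \<longrightarrow>
       (\<exists>(m::nat) (a::nat \<Rightarrow> 's) (t::nat \<Rightarrow> nat). m \<ge> 1 \<and> a \<in> {1..m+1} \<rightarrow> S \<and>
          t \<in> {1..m} \<rightarrow> {1..} \<and> strict_mono_on {1..m} t \<and>
          (\<forall>f\<in>F. p (ordered_prod p (\<lambda>j. p (a j) (f (t j))) m) (a (m+1)) \<in> D)))"

definition FS :: "(nat \<Rightarrow> 'b::comm_monoid_add) \<Rightarrow> 'b set" where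
  "FS x = {\<Sum>t\<in>H. x t | H. finite H \<and> H \<noteq> {} \<and> H \<subseteq> {1..}}"

definition IP_set :: "'b::comm_monoid_add set \<Rightarrow> bool" where
  "IP_set C \<longleftrightarrow> (\<exists>x. FS x \<subseteq> C)"

definition nat_scale :: "nat \<Rightarrow> 'b::comm_monoid_add \<Rightarrow> 'b" where
  "nat_scale c x = (\<Sum>i<c. x)"

text \<open>
  The library product \<open>*v\<close> needs matrix and vector entries in a common semiring, which is not
  available for vectors over a commutative monoid.
\<close>
definition mat_act :: "nat ^ 'm ^ 'k \<Rightarrow> 'b::comm_monoid_add ^ 'm \<Rightarrow> 'b ^ 'k" where
  "mat_act M v = (\<chi> i. \<Sum>j\<in>UNIV. nat_scale (M $ i $ j) (v $ j))"

definition box_prod :: "('k \<Rightarrow> 'b set) \<Rightarrow> ('b ^ 'k) set" where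
  "box_prod C = {v. \<forall>i. v $ i \<in> C i}"

end

theory Submission
  imports Defs "HOL-Library.Disjoint_Sets"
begin

text \<open>
  Applying the hypothesis on IP-sets to tails of the given sequences yields words
  \<open>w 0, w 1, \<dots>\<close> such that the \<open>i\<close>-th entry of \<open>M\<psi>(w s)\<close> is a sum of \<open>x i\<close> over an index set
  that moves to the right with \<open>s\<close>. The \<open>J\<close>-set property of \<open>D\<close> for the finitely many sequences
  \<open>s \<mapsto> \<nu>(w s)\<close>, where \<open>\<nu> \<in> F\<close>, gives \<open>a\<close> and \<open>t\<close>, and the word
  \<open>a 1 \<cdot> w (t 1) \<cdot> \<dots> \<cdot> a m \<cdot> w (t m) \<cdot> a (m + 1)\<close> is as required: every \<open>\<nu>\<close> leaves
  the \<open>a j\<close> fixed, while \<open>\<psi>\<close> ignores them, so \<open>M\<psi>\<close> maps this word to \<open>\<Sum>j. M\<psi>(w (t j))\<close>.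
\<close>

lemma ordered_prod_1 [simp]: "ordered_prod p y (Suc 0) = y (Suc 0)"
  by (simp add: ordered_prod_def)

text \<open>There is no neutral element to start from, so the recursion begins at
  \<open>m = 1\<close>; \<open>ordered_prod p y 0\<close> is the junk value \<open>y 1\<close>.
  Hence the inductions from 1 on below.\<close>

lemma ordered_prod_Suc [simp]:
  "m \<ge> 1 \<Longrightarrow> ordered_prod p y (Suc m) = p (ordered_prod p y m) (y (Suc m))"
  by (simp add: ordered_prod_def)

lemma ordered_prod_closed:
  assumes "\<And>u v. u \<in> S \<Longrightarrow> v \<in> S \<Longrightarrow> p u v \<in> S"
    and "m \<ge> 1" and "y \<in> {1..m} \<rightarrow> S"
  shows "ordered_prod p y m \<in> S"
  using assms(2,3)
proof (induction m rule: nat_induct_at_least)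
  case (Suc m)
  then have "ordered_prod p y m \<in> S" "y (Suc m) \<in> S" by (auto simp: Pi_iff)
  then show ?case using Suc.hyps assms(1) by simp
qed (auto simp: Pi_iff)

text \<open>\<open>h\<close> is multiplicative on \<open>S\<close> only, so closure of
  \<open>S\<close> must keep the partial products inside it. The target operation is arbitrary in
  order to cover both concatenation of words and addition of vectors.\<close>

lemma semigroup_hom_ordered_prod:
  assumes "semigroup_hom S p T q h"
    and "\<And>u v. u \<in> S \<Longrightarrow> v \<in> S \<Longrightarrow> p u v \<in> S"
    and "m \<ge> 1" and "y \<in> {1..m} \<rightarrow> S"
  shows "h (ordered_prod p y m) = ordered_prod q (\<lambda>j. h (y j)) m"
  using assms(3,4)
proof (induction m rule: nat_induct_at_least)
  case (Suc m)
  have "ordered_prod p y m \<in> S"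
    by (rule ordered_prod_closed) (use Suc assms(2) in \<open>auto simp: Pi_iff\<close>)
  moreover have "y (Suc m) \<in> S" using Suc.prems by (auto simp: Pi_iff)
  ultimately show ?case using Suc assms(1) by (auto simp: Pi_iff semigroup_hom_def)
qed simp

lemma ordered_prod_cong:
  assumes "m \<ge> 1" and "\<And>j. j \<in> {1..m} \<Longrightarrow> y j = z j"
  shows "ordered_prod p y m = ordered_prod p z m"
  using assms by (induction m rule: nat_induct_at_least) auto

lemma ordered_prod_plus:
  "m \<ge> 1 \<Longrightarrow> ordered_prod (+) y m = (\<Sum>j=1..m. y j)"
  by (induction m rule: nat_induct_at_least) auto

text \<open>All required variables already occur in \<open>u\<close>. The union treats closure of
  \<open>words A n\<close> and its being an ideal together.\<close>

lemma words_append: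
  assumes "u \<in> words A n" and "v \<in> words A n \<union> words A 0"
  shows "u @ v \<in> words A n" and "v @ u \<in> words A n"
  using assms unfolding words_def by auto

lemma nat_scale_add: "nat_scale c (u + v) = nat_scale c u + nat_scale c v"
  by (simp add: nat_scale_def sum.distrib)

lemma mat_act_add: "mat_act M (u + v) = mat_act M u + mat_act M v"
  by (simp add: mat_act_def vec_eq_iff nat_scale_add sum.distrib)

lemma S0_independentD:
  assumes "S0_independent A n \<tau>"
  shows "u \<in> words A n \<Longrightarrow> w \<in> words A n \<Longrightarrow> \<tau> (u @ w) = \<tau> u + \<tau> w"
    and "u \<in> words A 0 \<Longrightarrow> w \<in> words A n \<Longrightarrow> \<tau> (u @ w) = \<tau> w"
    and "u \<in> words A 0 \<Longrightarrow> w \<in> words A n \<Longrightarrow> \<tau> (w @ u) = \<tau> w"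
  using assms unfolding S0_independent_def semigroup_hom_def by metis+

text \<open>Each entry is a combination of the \<open>\<tau> i\<close> with coefficients in
  \<open>nat\<close>, additive because \<open>+\<close> is commutative. So \<open>M\<psi>\<close>
  can be handled as one homomorphism into \<open>'b ^ 'k\<close>.\<close>

lemma S0_independent_mat_act:
  assumes "\<And>i. S0_independent A n (\<tau> i)"
    and "\<And>w. w \<in> words A n \<Longrightarrow> \<psi> w = (\<chi> i. \<tau> i w)"
  shows "S0_independent A n (\<lambda>w. mat_act M (\<psi> w))"
proof -
  have "\<psi> (u @ w) = \<psi> u + \<psi> w" if "u \<in> words A n" "w \<in> words A n" for u w
    using that
    by (simp add: assms(2) words_append S0_independentD[OF assms(1)] vec_eq_iff)
  moreover have "\<psi> (u @ w) = \<psi> w" "\<psi> (w @ u) = \<psi> w"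
    if "u \<in> words A 0" "w \<in> words A n" for u w
    using that
    by (simp_all add: assms(2) words_append S0_independentD[OF assms(1)] vec_eq_iff)
  ultimately show ?thesis
    by (simp add: S0_independent_def semigroup_hom_def mat_act_add)
qed

text \<open>Shifting indices by \<open>N\<close> turns a tail into a sequence indexed from 1, to
  which the hypothesis on IP-sets applies.\<close>

lemma FS_tail: "FS (\<lambda>t. x (t + N)) = {\<Sum>t\<in>H. x t | H. finite H \<and> H \<noteq> {} \<and> H \<subseteq> {N<..}}"
proof (intro set_eqI iffI)
  fix y assume "y \<in> FS (\<lambda>t. x (t + N))"
  then obtain H where H: "finite H" "H \<noteq> {}" "H \<subseteq> {1..}" "y = (\<Sum>t\<in>H. x (t + N))"
    by (auto simp: FS_def)
  have "y = sum x ((\<lambda>t. t + N) ` H)"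
    by (simp add: H(4) sum.reindex)
  moreover have "(\<lambda>t. t + N) ` H \<subseteq> {N<..}" using H(3) by force
  ultimately show "y \<in> {\<Sum>t\<in>H. x t | H. finite H \<and> H \<noteq> {} \<and> H \<subseteq> {N<..}}"
    using H(1,2) by blast
next
  fix y assume "y \<in> {\<Sum>t\<in>H. x t | H. finite H \<and> H \<noteq> {} \<and> H \<subseteq> {N<..}}"
  then obtain H where H: "finite H" "H \<noteq> {}" "H \<subseteq> {N<..}" "y = sum x H"
    by blast
  have "sum x H = (\<Sum>t\<in>(\<lambda>t. t - N) ` H. x (t + N))"
    by (rule sum.reindex_bij_witness[of _ "\<lambda>t. t + N" "\<lambda>t. t - N"]) (use H(3) in force)+
  moreover have "(\<lambda>t. t - N) ` H \<subseteq> {1..}" using H(3) by force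
  ultimately show "y \<in> FS (\<lambda>t. x (t + N))"
    using H(1,2,4) unfolding FS_def by blast
qed

text \<open>Each word is chosen for the tails beyond all indices used before. Disjointness is what
  later merges several sums of \<open>x i\<close> into a single one.\<close>

lemma IP_sets_sequence:
  fixes x :: "'k::finite \<Rightarrow> nat \<Rightarrow> 'b::comm_monoid_add" and \<phi> :: "'w \<Rightarrow> 'b ^ 'k"
  assumes "\<And>C :: 'k \<Rightarrow> 'b set. (\<And>i. IP_set (C i)) \<Longrightarrow> \<exists>a\<in>W. \<phi> a \<in> box_prod C"
  shows "\<exists>w H. (\<forall>s. w s \<in> W \<and> (\<forall>i. finite (H s i) \<and> H s i \<noteq> {} \<and> H s i \<subseteq> {1..} \<and>
    \<phi> (w s) $ i = sum (x i) (H s i))) \<and> (\<forall>i. disjoint_family (\<lambda>s::nat. H s i))"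
proof -
  \<comment> \<open>The bound \<open>N'\<close> is common to all \<open>i\<close>, which is possible
    since \<open>'k\<close> is finite; the next choice can then start beyond
    \<open>N'\<close>.\<close>
  have "\<exists>w H N'. w \<in> W \<and> (\<forall>i. H i \<subseteq> {N<..N'} \<and> H i \<noteq> {} \<and> \<phi> w $ i = sum (x i) (H i))" for N
  proof -
    have "\<exists>w\<in>W. \<phi> w \<in> box_prod (\<lambda>i. FS (\<lambda>t. x i (t + N)))"
      by (rule assms) (auto simp: IP_set_def)
    then obtain w where w: "w \<in> W" "\<And>i. \<phi> w $ i \<in> FS (\<lambda>t. x i (t + N))"
      by (auto simp: box_prod_def)
    then have "\<forall>i. \<exists>H. finite H \<and> H \<noteq> {} \<and> H \<subseteq> {N<..} \<and> \<phi> w $ i = sum (x i) H"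
      unfolding FS_tail by blast
    then obtain H where H: "\<And>i. finite (H i)" "\<And>i. H i \<noteq> {}" "\<And>i. H i \<subseteq> {N<..}"
      "\<And>i. \<phi> w $ i = sum (x i) (H i)"
      by metis
    have "finite (\<Union>i. H i)" using H(1) by simp
    then have "t \<le> Max (\<Union>i. H i)" if "t \<in> H i" for t i
      using that by (intro Max_ge) auto
    then have "H i \<subseteq> {N<..Max (\<Union>i. H i)}" for i
      using H(3)[of i] by fastforce
    then show ?thesis using w(1) H(2,4) by blast
  qed
  then obtain g H h where g: "\<And>N. g N \<in> W" "\<And>N i. H N i \<subseteq> {N<..h N}"
    "\<And>N i. H N i \<noteq> {}" "\<And>N i. \<phi> (g N) $ i = sum (x i) (H N i)"
    by metis
  \<comment> \<open>The word for \<open>s\<close> uses indices in the block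
    \<open>{N s<..N (Suc s)}\<close> only; starting at 0 keeps all indices at least 1.\<close>
  define N where "N s = (h ^^ s) 0" for s
  have N_Suc: "N (Suc s) = h (N s)" for s by (simp add: N_def)
  \<comment> \<open>The block contains a nonempty \<open>H (N s) i\<close>; any \<open>i\<close>
    will do, here \<open>undefined\<close>.\<close>
  have "N s < N (Suc s)" for s
    using g(2,3)[of "N s" undefined] by (auto simp: N_Suc)
  then have mono: "s \<le> s' \<Longrightarrow> N s \<le> N s'" for s s'
    by (simp add: lift_Suc_mono_le less_imp_le)
  have less: "H (N s) i \<inter> H (N s') i = {}" if "s < s'" for s s' i
    using g(2)[of "N s" i] g(2)[of "N s'" i] mono[of "Suc s" s'] that by (fastforce simp: N_Suc)
  have "finite (H (N s) i) \<and> H (N s) i \<noteq> {} \<and> H (N s) i \<subseteq> {1..}" for s i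
    using g(2)[of "N s" i] g(3) finite_subset by fastforce
  moreover have "disjoint_family (\<lambda>s. H (N s) i)" for i
    using less unfolding disjoint_family_on_def by (metis Int_commute linorder_neq_iff)
  ultimately show ?thesis
    using g(1,4) by (intro exI[of _ "\<lambda>s. g (N s)"] exI[of _ "\<lambda>s. H (N s)"]) simp
qed

theorem theorem2p8:
  fixes A :: "'a set" and n :: nat
    and M :: "nat ^ 'm ^ 'k"
    and \<tau> :: "'m \<Rightarrow> 'a symb list \<Rightarrow> 'b::comm_monoid_add"
    and \<psi> :: "'a symb list \<Rightarrow> 'b ^ 'm"
    and F :: "('a symb list \<Rightarrow> 'a symb list) set"
    and D :: "'a symb list set"
    and x :: "'k \<Rightarrow> nat \<Rightarrow> 'b"
  assumes "A \<noteq> {}"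
    and "n \<ge> 1"
    and "\<And>i. S0_independent A n (\<tau> i)"
    and "\<And>w. w \<in> words A n \<Longrightarrow> \<psi> w = (\<chi> i. \<tau> i w)"
    and "\<And>C :: 'k \<Rightarrow> 'b set. (\<And>i. IP_set (C i)) \<Longrightarrow>
           \<exists>a\<in>words A n. mat_act M (\<psi> a) \<in> box_prod C"
    and "finite F" and "F \<noteq> {}"
    and "\<And>\<nu>. \<nu> \<in> F \<Longrightarrow> S0_preserving A n \<nu>"
    and "J_set (words A 0) (@) D"
  shows "\<exists>w\<in>words A n. (\<forall>\<nu>\<in>F. \<nu> w \<in> D) \<and> mat_act M (\<psi> w) \<in> box_prod (\<lambda>i. FS (x i))"
proof -
  define \<phi> where "\<phi> w = mat_act M (\<psi> w)" for w
  have \<phi>: "S0_independent A n \<phi>"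
    using S0_independent_mat_act[OF assms(3,4)] unfolding \<phi>_def by simp
  have ip: "\<exists>a\<in>words A n. \<phi> a \<in> box_prod C" if "\<And>i. IP_set (C i)" for C
    unfolding \<phi>_def using that by (rule assms(5))
  obtain w H where wH: "\<forall>s. w s \<in> words A n \<and> (\<forall>i. finite (H s i) \<and> H s i \<noteq> {} \<and>
      H s i \<subseteq> {1..} \<and> \<phi> (w s) $ i = sum (x i) (H s i))"
    and disj: "\<forall>i. disjoint_family (\<lambda>s::nat. H s i)"
    using IP_sets_sequence[where x = x, OF ip] by blast
  have w: "w s \<in> words A n" and \<phi>_w: "\<phi> (w s) $ i = sum (x i) (H s i)"
    and H: "finite (H s i)" "H s i \<noteq> {}" "H s i \<subseteq> {1..}" for s i
    using wH by blast+
  let ?F = "(\<lambda>\<nu> s. \<nu> (w s)) ` F"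
  have "?F \<subseteq> {1..} \<rightarrow> words A 0"
    using assms(8) w by (fastforce simp: S0_preserving_def semigroup_hom_def Pi_iff)
  moreover have "finite ?F" "?F \<noteq> {}" using assms(6,7) by auto
  ultimately obtain m :: nat and a t where m: "m \<ge> 1" and a: "a \<in> {1..m+1} \<rightarrow> words A 0"
    and t: "strict_mono_on {1..m} t"
    and D: "\<forall>f\<in>?F. ordered_prod (@) (\<lambda>j. a j @ f (t j)) m @ a (m+1) \<in> D"
    using assms(9) unfolding J_set_def by meson
  \<comment> \<open>Joining \<open>a j\<close> to the word after it makes every factor an
    \<open>n\<close>-variable word, so that the homomorphisms apply to the product. Only the last
    constant word \<open>a (m+1)\<close> remains separate.\<close>
  define y where "y j = a j @ w (t j)" for j
  have y: "y \<in> {1..m} \<rightarrow> words A n"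
    using a w by (auto simp: y_def Pi_iff intro!: words_append)
  let ?P = "ordered_prod (@) y m"
  have P: "?P \<in> words A n"
    by (rule ordered_prod_closed) (use m y in \<open>auto intro: words_append\<close>)
  have am: "a (m+1) \<in> words A 0" using a by auto
  show ?thesis
  proof (intro bexI conjI ballI)
    show "?P @ a (m+1) \<in> words A n" using P am by (auto intro: words_append)
  next
    fix \<nu> assume \<nu>: "\<nu> \<in> F"
    have pres: "S0_preserving A n \<nu>" using \<nu> by (rule assms(8))
    have "\<nu> ?P = ordered_prod (@) (\<lambda>j. \<nu> (y j)) m"
      using pres unfolding S0_preserving_def
      by (intro semigroup_hom_ordered_prod[where S = "words A n"])
        (use m y in \<open>auto intro: words_append\<close>)
    also have "\<dots> = ordered_prod (@) (\<lambda>j. a j @ \<nu> (w (t j))) m"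
      by (rule ordered_prod_cong[OF m])
        (use pres a w in \<open>auto simp: y_def S0_preserving_def Pi_iff\<close>)
    finally have "\<nu> (?P @ a (m+1)) = ordered_prod (@) (\<lambda>j. a j @ \<nu> (w (t j))) m @ a (m+1)"
      using pres P am by (simp add: S0_preserving_def)
    then show "\<nu> (?P @ a (m+1)) \<in> D" using D \<nu> by simp
  next
    have "\<phi> ?P = ordered_prod (+) (\<lambda>j. \<phi> (y j)) m"
      using \<phi> unfolding S0_independent_def
      by (intro semigroup_hom_ordered_prod[where S = "words A n"])
        (use m y in \<open>auto intro: words_append\<close>)
    also have "\<dots> = (\<Sum>j=1..m. \<phi> (y j))" by (rule ordered_prod_plus[OF m])
    \<comment> \<open>Independence removes the constant words \<open>a j\<close>.\<close>
    also have "\<dots> = (\<Sum>j=1..m. \<phi> (w (t j)))"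
      by (rule sum.cong) (use a w in \<open>auto simp: y_def S0_independentD[OF \<phi>] Pi_iff\<close>)
    finally have \<phi>_P: "\<phi> (?P @ a (m+1)) = (\<Sum>j=1..m. \<phi> (w (t j)))"
      using P am by (simp add: S0_independentD[OF \<phi>])
    have "\<phi> (?P @ a (m+1)) $ i \<in> FS (x i)" for i
    proof -
      \<comment> \<open>Since \<open>t\<close> is injective, distinct \<open>j\<close> select
        distinct members of the disjoint family.\<close>
      have dis: "H (t j) i \<inter> H (t j') i = {}" if "j \<in> {1..m}" "j' \<in> {1..m}" "j \<noteq> j'" for j j'
        using strict_mono_on_imp_inj_on[OF t] that disj
        by (intro disjoint_family_onD[of _ UNIV]) (auto dest: inj_onD)
      have "\<phi> (?P @ a (m+1)) $ i = (\<Sum>j=1..m. sum (x i) (H (t j) i))"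
        unfolding \<phi>_P by (simp add: \<phi>_w)
      also have "\<dots> = sum (x i) (\<Union>j\<in>{1..m}. H (t j) i)"
        by (rule sum.UNION_disjoint[symmetric]) (use H(1) dis in blast)+
      finally have "\<phi> (?P @ a (m+1)) $ i = sum (x i) (\<Union>j\<in>{1..m}. H (t j) i)" .
      \<comment> \<open>As \<open>m \<ge> 1\<close>, the index \<open>j = m\<close> contributes a
        nonempty set.\<close>
      moreover have "(\<Union>j\<in>{1..m}. H (t j) i) \<noteq> {}"
        using H(2)[of "t m" i] m by fastforce
      moreover have "(\<Union>j\<in>{1..m}. H (t j) i) \<subseteq> {1..}" using H(3) by blast
      moreover have "finite (\<Union>j\<in>{1..m}. H (t j) i)" using H(1) by blast
      ultimately show ?thesis unfolding FS_def by blast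
    qed
    then show "mat_act M (\<psi> (?P @ a (m+1))) \<in> box_prod (\<lambda>i. FS (x i))"
      by (simp add: box_prod_def \<phi>_def)
  qed
qed

end
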